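(* Let $p$ be a prime number. For any integers $a, b, m, n, s \in \{1, 2, \ldots, p-1\}$ with $a \neq b$, we have the following congruence modulo $p$: $$\sum_{k=0}^{p-1} (a+k)^m (b+k)^n k^s \equiv \begin{cases} 0, & \text{if } m+n+s < p-1,\\ -I_1, & \text{if } p-1 \leq m+n+s < 2(p-1),\\ -I_2-I_3, & \text{if } 2(p-1) \leq m+n+s < 3(p-1),\\ -3, & \text{if } m=n=s=p-1, \end{cases}$$ where $M:=m+n+s-(p-1)$, $R:=m+n+s-2(p-1)$ and $$I_1:=\sum_{j=0}^{M}\binom{m}{M-j}\binom{n}{j}a^{M-j}b^j=\sum_{j=0}^{M}\binom{m}{j}\binom{n}{M-j}a^{j}b^{M-j},$$ $$I_2:=\sum_{j=M-m}^{n}\binom{m}{M-j}\binom{n}{j}a^{M-j}b^j=\sum_{j=M-n}^{m} \binom{m}{j}\binom{n}{M-j}a^{j} b^{M-j},$$ $$I_3:=\sum_{j=0}^{R}\binom{m}{R-j}\binom{n}{j}a^{R-j}b^j.$$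
   Context: Binomial coefficients $\binom{u}{v}$ are $0$ unless $0 \le v \le u$. $I_1$, $I_2$, $I_3$ are only used in the cases in which they appear. *)

theory Defs
  imports "HOL-Number_Theory.Number_Theory"
begin

text \<open>
  All subtractions below are on \<^typ>\<open>nat\<close>. None of them truncates in the cases where the
  respective quantity is used: for \<open>1 \<le> m, n, s \<le> p - 1\<close>, the sum \<open>I\<^sub>1\<close> is used only if
  \<open>p - 1 \<le> m + n + s\<close>, while \<open>I\<^sub>2\<close> and \<open>I\<^sub>3\<close> are used only if \<open>2 * (p - 1) \<le> m + n + s\<close>;
  in the latter case \<open>M \<ge> p - 1\<close>, hence \<open>M \<ge> m\<close> and \<open>M \<ge> n\<close>.
\<close>

definition M_exp :: "nat \<Rightarrow> nat \<Rightarrow> nat \<Rightarrow> nat \<Rightarrow> nat" where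
  "M_exp p m n s = m + n + s - (p - 1)"

definition R_exp :: "nat \<Rightarrow> nat \<Rightarrow> nat \<Rightarrow> nat \<Rightarrow> nat" where
  "R_exp p m n s = m + n + s - 2 * (p - 1)"

definition I1 :: "nat \<Rightarrow> nat \<Rightarrow> nat \<Rightarrow> nat \<Rightarrow> int \<Rightarrow> int \<Rightarrow> int" where
  "I1 p m n s a b = (let M = M_exp p m n s in
     \<Sum>j=0..M. int (m choose (M - j)) * int (n choose j) * a ^ (M - j) * b ^ j)"

definition I2 :: "nat \<Rightarrow> nat \<Rightarrow> nat \<Rightarrow> nat \<Rightarrow> int \<Rightarrow> int \<Rightarrow> int" where
  "I2 p m n s a b = (let M = M_exp p m n s in
     \<Sum>j=M - m..n. int (m choose (M - j)) * int (n choose j) * a ^ (M - j) * b ^ j)"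

definition I3 :: "nat \<Rightarrow> nat \<Rightarrow> nat \<Rightarrow> nat \<Rightarrow> int \<Rightarrow> int \<Rightarrow> int" where
  "I3 p m n s a b = (let R = R_exp p m n s in
     \<Sum>j=0..R. int (m choose (R - j)) * int (n choose j) * a ^ (R - j) * b ^ j)"

end

theory Submission
  imports Defs
begin

text \<open>
  Expand \<open>(a + x) ^ m * (b + x) ^ n\<close> in powers of \<open>x\<close> and sum over \<open>x = 0, \<dots>, p - 1\<close>. A power sum
  \<open>\<Sum>k<p. k ^ e\<close> with \<open>e > 0\<close> vanishes modulo \<open>p\<close> unless \<open>p - 1\<close> divides \<open>e\<close>, in which case it
  is \<open>-1\<close> (lemma \<open>power_sum_cong_prime\<close>). So only those coefficients survive that belong to an
  exponent divisible by \<open>p - 1\<close>; each contributes with the sign \<open>-1\<close>. This is lemma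
  \<open>sum_shifted_powers_cong\<close>.

  The exponents that occur lie between \<open>s > 0\<close> and \<open>m + n + s\<close>. Below \<open>p - 1\<close> no multiple of
  \<open>p - 1\<close> is available; below \<open>2 * (p - 1)\<close> only \<open>p - 1\<close> is, which gives \<open>I\<^sub>1\<close>; below
  \<open>3 * (p - 1)\<close> both \<open>p - 1\<close> and \<open>2 * (p - 1)\<close> are, which gives \<open>I\<^sub>2\<close> and \<open>I\<^sub>3\<close>.
  The various forms of the \<open>I\<^sub>i\<close> are one and the same convolution, written in either order and
  with or without its vanishing terms.

  In the extreme case \<open>m = n = s = p - 1\<close> no expansion is needed: by Fermat every summand is \<open>1\<close>,
  except for the three distinct residues \<open>k = 0\<close>, \<open>k = -a\<close>, \<open>k = -b\<close>, where it is \<open>0\<close>.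
  So the sum is \<open>p - 3\<close>.
\<close>

section \<open>Power sums modulo a prime\<close>

text \<open>
  Multiplication by a primitive root \<open>g\<close> permutes the residues, so the sum is invariant under
  multiplication by \<open>g ^ e\<close>. If \<open>p - 1\<close> does not divide \<open>e\<close>, then \<open>g ^ e - 1\<close> is invertible
  and the sum must vanish. The exponent \<open>0\<close> is excluded because \<open>0 ^ 0 = 1\<close> would add a further
  term.
\<close>

lemma power_sum_cong_prime:
  fixes p e :: nat
  assumes p: "prime p" and e: "e > 0"
  shows "[(\<Sum>k<p. int k ^ e) = (if (p - 1) dvd e then - 1 else 0)] (mod int p)"
proof (cases "(p - 1) dvd e")
  case True
  then obtain q where q: "e = (p - 1) * q" by (elim dvdE)
  have p1: "p > 1" using p by (rule prime_gt_1_nat)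
  have one: "[int k ^ e = 1] (mod int p)" if "k \<in> {1..<p}" for k
  proof -
    have "\<not> p dvd k" using that by (auto dest: dvd_imp_le)
    then have "[k ^ (p - 1) = 1] (mod p)" using fermat_theorem[OF p] by simp
    then have "[(k ^ (p - 1)) ^ q = 1 ^ q] (mod p)" by (rule cong_pow)
    then have "[k ^ e = 1] (mod p)" by (simp add: q power_mult)
    then show ?thesis using cong_int_iff[of "k ^ e" 1 p] by simp
  qed
  have split: "{..<p} = insert 0 {1..<p}" using p1 by auto
  have "(\<Sum>k<p. int k ^ e) = (\<Sum>k\<in>{1..<p}. int k ^ e)"
    unfolding split using e by simp
  also have "[\<dots> = (\<Sum>k\<in>{1..<p}. 1)] (mod int p)"
    by (rule cong_sum) (rule one)
  also have "(\<Sum>k\<in>{1..<p}. 1) = int p - 1" using p1 by simp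
  also have "[int p - 1 = - 1] (mod int p)" by (simp add: cong_iff_dvd_diff)
  finally show ?thesis using True by simp
next
  case False
  have p1: "p > 1" using p by (rule prime_gt_1_nat)
  obtain g where "residue_primroot p g" using prime_primitive_root_exists[OF p1 p] by blast
  then have cop: "coprime p g" and ord: "ord p g = p - 1"
    using p by (auto simp: residue_primroot_def totient_prime)
  have inj: "inj_on (\<lambda>k. g * k mod p) {..<p}"
  proof (rule inj_onI)
    fix x y assume xy: "x \<in> {..<p}" "y \<in> {..<p}" and "g * x mod p = g * y mod p"
    then have "[g * x = g * y] (mod p)" by (simp add: cong_def)
    then have "[x = y] (mod p)" using cop by (simp add: cong_mult_lcancel_nat coprime_commute)
    then show "x = y" using xy by (simp add: cong_def)
  qed
  have img: "(\<lambda>k. g * k mod p) ` {..<p} = {..<p}"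
    using p1 by (intro endo_inj_surj inj) auto
  let ?S = "\<Sum>k<p. int k ^ e"
  have "?S = (\<Sum>k<p. int (g * k mod p) ^ e)"
    using sum.reindex[OF inj, of "\<lambda>k. int k ^ e"] by (simp add: img)
  also have "[\<dots> = (\<Sum>k<p. int (g * k) ^ e)] (mod int p)"
    by (intro cong_sum cong_pow) (simp add: cong_def zmod_int)
  also have "(\<Sum>k<p. int (g * k) ^ e) = int g ^ e * ?S"
    by (simp add: power_mult_distrib sum_distrib_left)
  finally have "int p dvd (int g ^ e - 1) * ?S"
    by (simp add: cong_iff_dvd_diff algebra_simps dvd_diff_commute)
  moreover have "\<not> int p dvd int g ^ e - 1"
  proof
    assume "int p dvd int g ^ e - 1"
    then have "[g ^ e = 1] (mod p)"
      using cong_int_iff[of "g ^ e" 1 p] by (simp add: cong_iff_dvd_diff)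
    then show False using False unfolding ord_divides ord by contradiction
  qed
  ultimately have "int p dvd ?S"
    using p prime_dvd_mult_iff[of "int p"] by simp
  then show ?thesis using False by (simp add: cong_0_iff)
qed

section \<open>Expansion of the shifted powers\<close>

text \<open>
  This is the coefficient of \<open>x ^ (m + n - d)\<close> in \<open>(a + x) ^ m * (b + x) ^ n\<close>.
  Indexing by \<open>d\<close>, the total degree in \<open>a\<close> and \<open>b\<close>, keeps the powers of \<open>a\<close> and \<open>b\<close> free of \<open>m\<close> and \<open>n\<close>.
\<close>

definition shifted_coeff :: "nat \<Rightarrow> nat \<Rightarrow> int \<Rightarrow> int \<Rightarrow> nat \<Rightarrow> int" where
  "shifted_coeff m n a b d =
     (\<Sum>j=0..d. int (m choose (d - j)) * int (n choose j) * a ^ (d - j) * b ^ j)"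

lemma shifted_coeff_rev:
  "shifted_coeff m n a b d =
     (\<Sum>j=0..d. int (m choose j) * int (n choose (d - j)) * a ^ j * b ^ (d - j))"
  unfolding shifted_coeff_def
  by (subst sum.atLeastAtMost_rev) (auto intro!: sum.cong)

lemma shifted_coeff_commute: "shifted_coeff m n a b d = shifted_coeff n m b a d"
  by (subst shifted_coeff_rev) (simp add: shifted_coeff_def mult_ac)

text \<open>
  The dropped terms have \<open>d - j > m\<close> or \<open>j > n\<close>, so one of their binomial coefficients is \<open>0\<close>.
\<close>

lemma shifted_coeff_trim:
  assumes "n \<le> d"
  shows "shifted_coeff m n a b d =
     (\<Sum>j=d - m..n. int (m choose (d - j)) * int (n choose j) * a ^ (d - j) * b ^ j)"
  unfolding shifted_coeff_def using assms
  by (intro sum.mono_neutral_right) (auto simp: not_le binomial_eq_0)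

text \<open>
  The two binomial expansions give a sum over a rectangle of index pairs. Enlarging it to the
  triangle \<open>i + j \<le> m + n\<close> adds only vanishing binomial coefficients, and the triangle can be
  summed along its diagonals.
\<close>

lemma shifted_powers_expand:
  fixes a b x :: int
  shows "(a + x) ^ m * (b + x) ^ n = (\<Sum>d\<le>m + n. shifted_coeff m n a b d * x ^ (m + n - d))"
proof -
  define f where "f i j = int (m choose i) * int (n choose j) * a ^ i * b ^ j * x ^ (m + n - (i + j))"
    for i j
  have "(a + x) ^ m * (b + x) ^ n =
      (\<Sum>i\<le>m. \<Sum>j\<le>n. (int (m choose i) * a ^ i * x ^ (m - i)) * (int (n choose j) * b ^ j * x ^ (n - j)))"
    by (simp add: binomial_ring sum_product)
  also have "\<dots> = (\<Sum>i\<le>m. \<Sum>j\<le>n. f i j)"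
  proof (intro sum.cong refl)
    fix i j assume "i \<in> {..m}" "j \<in> {..n}"
    then have "m + n - (i + j) = (m - i) + (n - j)" by auto
    then show "(int (m choose i) * a ^ i * x ^ (m - i)) * (int (n choose j) * b ^ j * x ^ (n - j)) = f i j"
      by (simp add: f_def power_add)
  qed
  also have "\<dots> = (\<Sum>(i, j)\<in>{..m} \<times> {..n}. f i j)"
    by (simp add: sum.cartesian_product)
  also have "\<dots> = (\<Sum>(i, j)\<in>{(i, j). i + j \<le> m + n}. f i j)"
  proof (rule sum.mono_neutral_left)
    show "finite {(i, j). i + j \<le> m + n}"
      by (rule finite_subset[of _ "{..m + n} \<times> {..m + n}"]) auto
  qed (auto simp: f_def not_le)
  also have "\<dots> = (\<Sum>d\<le>m + n. \<Sum>i\<le>d. f i (d - i))"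
    by (rule sum.triangle_reindex_eq)
  also have "\<dots> = (\<Sum>d\<le>m + n. shifted_coeff m n a b d * x ^ (m + n - d))"
    by (intro sum.cong refl)
      (simp add: shifted_coeff_rev f_def sum_distrib_right atMost_atLeast0)
  finally show ?thesis .
qed

lemma sum_shifted_powers_cong:
  fixes a b :: int
  assumes p: "prime p" and s: "s > 0"
  shows "[(\<Sum>k=0..p - 1. (a + int k) ^ m * (b + int k) ^ n * int k ^ s) =
      - (\<Sum>d\<in>{d. d \<le> m + n \<and> (p - 1) dvd (m + n + s - d)}. shifted_coeff m n a b d)] (mod int p)"
proof -
  have range: "{0..p - 1} = {..<p}" using prime_gt_1_nat[OF p] by auto
  have exponent: "x ^ (m + n - d) * x ^ s = x ^ (m + n + s - d)" if "d \<le> m + n" for d and x :: int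
    using that by (simp add: power_add[symmetric])
  have "(\<Sum>k=0..p - 1. (a + int k) ^ m * (b + int k) ^ n * int k ^ s) =
      (\<Sum>k<p. \<Sum>d\<le>m + n. shifted_coeff m n a b d * int k ^ (m + n + s - d))"
    unfolding range shifted_powers_expand
    by (simp add: sum_distrib_right mult.assoc exponent)
  also have "\<dots> = (\<Sum>d\<le>m + n. shifted_coeff m n a b d * (\<Sum>k<p. int k ^ (m + n + s - d)))"
    by (subst sum.swap) (simp add: sum_distrib_left)
  also have "[\<dots> = (\<Sum>d\<le>m + n. shifted_coeff m n a b d *
      (if (p - 1) dvd (m + n + s - d) then - 1 else 0))] (mod int p)"
    using s by (intro cong_sum cong_mult cong_refl power_sum_cong_prime[OF p]) auto
  also have "(\<Sum>d\<le>m + n. shifted_coeff m n a b d * (if (p - 1) dvd (m + n + s - d) then - 1 else 0)) =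
      (\<Sum>d\<le>m + n. if (p - 1) dvd (m + n + s - d) then - shifted_coeff m n a b d else 0)"
    by (intro sum.cong) auto
  also have "\<dots> = - (\<Sum>d\<in>{d. d \<le> m + n \<and> (p - 1) dvd (m + n + s - d)}. shifted_coeff m n a b d)"
    by (subst sum.inter_filter[symmetric]) (simp_all add: sum_negf)
  finally show ?thesis .
qed

section \<open>All exponents equal to \<open>p - 1\<close>\<close>

text \<open>
  By Fermat, \<open>x ^ (p - 1)\<close> is the indicator of \<open>x\<close> being nonzero modulo \<open>p\<close>, so the sum counts
  the residues \<open>k\<close> at which none of the three factors vanishes. The bounds on \<open>a\<close> and \<open>b\<close> and
  \<open>a \<noteq> b\<close> make the three zeros distinct.
\<close>

lemma sum_full_powers_cong:
  fixes a b :: int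
  assumes p: "prime p"
    and a: "a \<in> {1..int p - 1}" and b: "b \<in> {1..int p - 1}" and ab: "a \<noteq> b"
  shows "[(\<Sum>k=0..p - 1. (a + int k) ^ (p - 1) * (b + int k) ^ (p - 1) * int k ^ (p - 1)) = - 3] (mod int p)"
proof -
  have p1: "p > 1" using p by (rule prime_gt_1_nat)
  have range: "{0..p - 1} = {..<p}" using p1 by auto
  define Z where "Z = {0, p - nat a, p - nat b}"
  have "0 < p - nat a" "0 < p - nat b" "p - nat a \<noteq> p - nat b" using a b ab by auto
  then have Z: "Z \<subseteq> {..<p}" "card Z = 3" using a b p1 by (auto simp: Z_def)
  have fermat: "[x ^ (p - 1) = (if int p dvd x then 0 else 1)] (mod int p)" for x :: int
  proof (cases "int p dvd x")
    case True
    then show ?thesis using p1 by (simp add: cong_0_iff dvd_power_le[of _ _ 1, simplified])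
  next
    case False
    have cop: "\<not> p dvd nat (x mod int p)"
      using False p1 by (auto simp: int_dvd_int_iff[symmetric] dvd_mod_iff)
    have "[nat (x mod int p) ^ (p - 1) = 1] (mod p)"
      using fermat_theorem[OF p cop] by simp
    then have "[int (nat (x mod int p) ^ (p - 1)) = int 1] (mod int p)"
      by (simp only: cong_int_iff)
    then have "[(x mod int p) ^ (p - 1) = 1] (mod int p)" using p1 by simp
    then show ?thesis using False by (simp add: cong_def power_mod)
  qed
  have dvd_shift: "int p dvd c + int k \<longleftrightarrow> k = p - nat c"
    if c: "c \<in> {1..int p - 1}" and k: "k < p" for c k
  proof
    assume "int p dvd c + int k"
    then obtain q where q: "c + int k = int p * q" by (elim dvdE)
    have "int p * 0 < int p * q" "int p * q < int p * 2" using c k unfolding q[symmetric] by auto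
    then have "0 < q" "q < 2" using p1 by (simp_all only: mult_less_cancel_left_pos of_nat_0_less_iff)
    then have "q = 1" by simp
    then show "k = p - nat c" using q c by auto
  next
    assume "k = p - nat c"
    then have "c + int k = int p" using c by auto
    then show "int p dvd c + int k" by simp
  qed
  have dvd_zero: "p dvd k \<longleftrightarrow> k = 0" if "k < p" for k
    using that by (auto dest: dvd_imp_le)
  have "[(\<Sum>k<p. (a + int k) ^ (p - 1) * (b + int k) ^ (p - 1) * int k ^ (p - 1)) =
      (\<Sum>k<p. (if int p dvd a + int k then 0 else 1) * (if int p dvd b + int k then 0 else 1)
        * (if int p dvd int k then 0 else 1))] (mod int p)"
    by (intro cong_sum cong_mult fermat)
  also have "(\<Sum>k<p. (if int p dvd a + int k then 0 else 1) * (if int p dvd b + int k then 0 else 1)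
        * (if int p dvd int k then 0 else 1)) = (\<Sum>k<p. if k \<in> {..<p} - Z then 1 else (0::int))"
    by (intro sum.cong refl) (simp add: dvd_shift[OF a] dvd_shift[OF b] dvd_zero Z_def)
  also have "\<dots> = int (card ({..<p} - Z))"
    by (simp add: sum.If_cases Diff_eq Compl_eq)
  also have "\<dots> = int p - 3"
    using Z card_mono[OF _ Z(1)] by (simp add: card_Diff_subset finite_subset[OF Z(1)])
  also have "[int p - 3 = - 3] (mod int p)" by (simp add: cong_iff_dvd_diff)
  finally show ?thesis unfolding range .
qed

section \<open>The four ranges of the total degree\<close>

theorem theorem3p1:
  fixes p m n s :: nat and a b :: int
  assumes "prime p"
    and "a \<in> {1..int p - 1}" and "b \<in> {1..int p - 1}"
    and "m \<in> {1..p - 1}" and "n \<in> {1..p - 1}" and "s \<in> {1..p - 1}"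
    and "a \<noteq> b"
  defines "S \<equiv> (\<Sum>k=0..p - 1. (a + int k) ^ m * (b + int k) ^ n * int k ^ s)"
    and "M \<equiv> M_exp p m n s"
  shows
    "(m + n + s < p - 1 \<longrightarrow> [S = 0] (mod int p)) \<and>
     (p - 1 \<le> m + n + s \<and> m + n + s < 2 * (p - 1) \<longrightarrow>
        [S = - I1 p m n s a b] (mod int p) \<and>
        I1 p m n s a b =
          (\<Sum>j=0..M. int (m choose j) * int (n choose (M - j)) * a ^ j * b ^ (M - j))) \<and>
     (2 * (p - 1) \<le> m + n + s \<and> m + n + s < 3 * (p - 1) \<longrightarrow>
        [S = - I2 p m n s a b - I3 p m n s a b] (mod int p) \<and>
        I2 p m n s a b =
          (\<Sum>j=M - n..m. int (m choose j) * int (n choose (M - j)) * a ^ j * b ^ (M - j))) \<and>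
     (m = p - 1 \<and> n = p - 1 \<and> s = p - 1 \<longrightarrow> [S = - 3] (mod int p))"
proof -
  define N where "N = p - 1"
  have N: "N > 0" using prime_gt_1_nat[OF assms(1)] by (simp add: N_def)
  have le: "m \<le> N" "n \<le> N" "s \<le> N" "s > 0" using assms(4-6) by (auto simp: N_def)
  let ?D = "{d. d \<le> m + n \<and> N dvd (m + n + s - d)}"
  let ?c = "shifted_coeff m n a b"
  have S: "[S = - (\<Sum>d\<in>?D. ?c d)] (mod int p)"
    unfolding S_def N_def by (rule sum_shifted_powers_cong[OF assms(1) le(4)])
  have exponent_cases: "m + n + s = d + N \<or> m + n + s = d + 2 * N"
    if d: "d \<le> m + n" "N dvd (m + n + s - d)" and lt: "m + n + s < 3 * N" for d
  proof -
    obtain q where q: "m + n + s - d = N * q" using d(2) by (elim dvdE)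
    have "0 < N * q" "N * q < N * 3" using q d(1) lt le(4) by linarith+
    then have "q = 1 \<or> q = 2" by auto
    then show ?thesis using q d(1) by auto
  qed
  have M: "M = m + n + s - N" by (simp add: M_def M_exp_def N_def)
  show ?thesis
    unfolding N_def[symmetric]
  proof (intro conjI impI; (elim conjE)?)
    assume lt: "m + n + s < N"
    have D: "?D = {}" using exponent_cases lt by fastforce
    show "[S = 0] (mod int p)" using S by (simp only: D sum.empty minus_zero)
  next
    assume ge: "N \<le> m + n + s" and lt: "m + n + s < 2 * N"
    \<comment> \<open>\<open>M\<close> is a possible degree, at most \<open>m + n\<close>, because \<open>s \<le> p - 1\<close>.\<close>
    have "?D = {M}"
      using exponent_cases ge lt le by (auto simp: M) fastforce
    moreover have "I1 p m n s a b = ?c M"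
      by (simp add: I1_def Let_def shifted_coeff_def M_def)
    ultimately show "[S = - I1 p m n s a b] (mod int p)" using S by simp
  next
    show "I1 p m n s a b =
        (\<Sum>j=0..M. int (m choose j) * int (n choose (M - j)) * a ^ j * b ^ (M - j))"
      by (simp add: I1_def Let_def shifted_coeff_def[symmetric] M_def shifted_coeff_rev)
  next
    assume ge: "2 * N \<le> m + n + s" and lt: "m + n + s < 3 * N"
    define R where "R = m + n + s - 2 * N"
    have D: "?D = {M, R}"
    proof (intro equalityI subsetI)
      fix d assume "d \<in> ?D"
      then show "d \<in> {M, R}" using exponent_cases[of d] lt by (auto simp: M R_def)
    next
      fix d assume "d \<in> {M, R}"
      then have "d \<le> m + n" "m + n + s - d = N * 1 \<or> m + n + s - d = N * 2"
        using ge le by (auto simp: M R_def)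
      then show "d \<in> ?D" by auto
    qed
    have "M \<noteq> R" using ge N by (simp add: M R_def)
    moreover have "I2 p m n s a b = ?c M"
      using ge le by (subst shifted_coeff_trim) (auto simp: M I2_def M_exp_def Let_def N_def)
    moreover have "I3 p m n s a b = ?c R"
      by (simp add: I3_def R_exp_def R_def N_def Let_def shifted_coeff_def)
    ultimately show "[S = - I2 p m n s a b - I3 p m n s a b] (mod int p)" using S by (simp add: D)
  next
    assume ge: "2 * N \<le> m + n + s"
    have "m \<le> M" "n \<le> M" using ge le by (auto simp: M)
    then have "I2 p m n s a b = ?c M"
      by (subst shifted_coeff_trim) (auto simp: M I2_def M_exp_def Let_def N_def)
    also have "\<dots> = shifted_coeff n m b a M" by (rule shifted_coeff_commute)
    also have "\<dots> = (\<Sum>j=M - n..m. int (m choose j) * int (n choose (M - j)) * a ^ j * b ^ (M - j))"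
      using \<open>m \<le> M\<close> by (subst shifted_coeff_trim) (simp_all add: mult_ac)
    finally show "I2 p m n s a b =
        (\<Sum>j=M - n..m. int (m choose j) * int (n choose (M - j)) * a ^ j * b ^ (M - j))" .
  next
    assume "m = N" "n = N" "s = N"
    then show "[S = - 3] (mod int p)"
      unfolding S_def using sum_full_powers_cong[OF assms(1-3,7)] by (simp add: N_def)
  qed
qed

end
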